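(* Let $\Delta$ be a $(d-1)$-dimensional flag Eulerian complex with $n$ vertices, and let $f_1$ be the number of edges of $\Delta$. Then $f_1<n^2/4+3n/2$ if $d=4$, and $f_1<n^2/4+3n$ if $d=5$.
   Context: A simplicial complex $\Delta$ with (finite) vertex set $V$ is a non-empty collection of subsets (faces) of $V$ closed under inclusion and containing all singletons. A face of size $i+1$ has dimension $i$; edges are $1$-dimensional faces; $f_i(\Delta)$ is the number of $i$-dimensional faces. A missing face of $\Delta$ is a subset of $V$ that is not a face but all of whose proper subsets are faces; its dimension is its size minus one. $\Delta$ is flag if all of its missing faces are $1$-dimensional. The link of a face $F$ is $\mathrm{lk}(F,\Delta)=\{\sigma\in\Delta: \sigma\cup F\in\Delta,\ \sigma\cap F=\emptyset\}$. The reduced Euler characteristic is $\tilde\chi(\Delta)=\sum_{i=-1}^{\dim\Delta}(-1)^i f_i(\Delta)$. $\Delta$ is Eulerian if $\tilde\chi(\mathrm{lk}(F,\Delta))=(-1)^{\dim\Delta-\dim F-1}$ for every face $F$ of $\Delta$, including the empty face. *)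

theory Defs
  imports Complex_Main
begin

definition simplicial_complex :: "'a set \<Rightarrow> 'a set set \<Rightarrow> bool" where
  "simplicial_complex V \<Delta> \<longleftrightarrow>
     finite V \<and> \<Delta> \<noteq> {} \<and> \<Delta> \<subseteq> Pow V \<and>
     (\<forall>F\<in>\<Delta>. \<forall>G\<subseteq>F. G \<in> \<Delta>) \<and> (\<forall>v\<in>V. {v} \<in> \<Delta>)"

text \<open>Dimensions are integers, so that the empty face has dimension \<open>-1\<close>.\<close>

definition face_dim :: "'a set \<Rightarrow> int" where
  "face_dim F = int (card F) - 1"

definition complex_dim :: "'a set set \<Rightarrow> int" where
  "complex_dim \<Delta> = Max (face_dim ` \<Delta>)"

definition face_number :: "int \<Rightarrow> 'a set set \<Rightarrow> nat" where
  "face_number i \<Delta> = card {F \<in> \<Delta>. face_dim F = i}"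

definition missing_face :: "'a set \<Rightarrow> 'a set set \<Rightarrow> 'a set \<Rightarrow> bool" where
  "missing_face V \<Delta> F \<longleftrightarrow> F \<subseteq> V \<and> F \<notin> \<Delta> \<and> (\<forall>G. G \<subset> F \<longrightarrow> G \<in> \<Delta>)"

definition flag_complex :: "'a set \<Rightarrow> 'a set set \<Rightarrow> bool" where
  "flag_complex V \<Delta> \<longleftrightarrow> (\<forall>F. missing_face V \<Delta> F \<longrightarrow> face_dim F = 1)"

definition link :: "'a set \<Rightarrow> 'a set set \<Rightarrow> 'a set set" where
  "link F \<Delta> = {\<sigma> \<in> \<Delta>. \<sigma> \<union> F \<in> \<Delta> \<and> \<sigma> \<inter> F = {}}"

text \<open>Real-valued only because \<open>powi\<close>, needed for the exponent \<open>-1\<close>, is not available on \<open>int\<close>.\<close>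

definition reduced_euler_char :: "'a set set \<Rightarrow> real" where
  "reduced_euler_char \<Delta> =
     (\<Sum>i = -1..complex_dim \<Delta>. (-1) powi i * real (face_number i \<Delta>))"

definition eulerian :: "'a set set \<Rightarrow> bool" where
  "eulerian \<Delta> \<longleftrightarrow>
     (\<forall>F\<in>\<Delta>. reduced_euler_char (link F \<Delta>) = (-1) powi (complex_dim \<Delta> - face_dim F - 1))"

end

(* The Eulerian condition yields the Dehn-Sommerville relations, which express the number of
   triangles as f_2 = 2 (f_1 - n) if d = 4 and as f_2 = 4 f_1 - 10 n + 20 if d = 5. By flagness,
   f_2 counts all triangles of the underlying graph, so the Goodman-Moon-Moser bound
   f_2 >= f_1 (4 f_1 - n^2) / (3 n) applies; comparing the two gives the claim. *)
theory Submission
  imports Defs "HOL-Combinatorics.Multiset_Permutations" "HOL-Analysis.Convex"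
begin

section \<open>Triangles in graphs\<close>

text \<open>Here \<open>a\<close> is an adjacency matrix, so \<open>D\<close> is the degree sum and
  counts ordered edges. An adjacent pair u, v has at least deg u + deg v - n common neighbours.
  Summing over ordered edges bounds the ordered triangles below by 2 S - n D, with S the sum of the
  squared degrees, and Cauchy-Schwarz gives D^2 \<le> n S.\<close>

lemma goodman_weighted_bound:
  fixes a :: "'a \<Rightarrow> 'a \<Rightarrow> real"
  assumes "finite V"
    and a01: "\<And>u v. a u v = 0 \<or> a u v = 1"
    and sym: "\<And>u v. a u v = a v u"
  defines "D \<equiv> \<Sum>u\<in>V. \<Sum>v\<in>V. a u v"
  shows "D * (2 * D - (real (card V))\<^sup>2)
    \<le> real (card V) * (\<Sum>u\<in>V. \<Sum>v\<in>V. \<Sum>w\<in>V. a u v * a v w * a u w)"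
proof -
  define n where "n = real (card V)"
  define deg where "deg u = (\<Sum>v\<in>V. a u v)" for u
  define S where "S = (\<Sum>u\<in>V. (deg u)\<^sup>2)"
  define T where "T = (\<Sum>u\<in>V. \<Sum>v\<in>V. \<Sum>w\<in>V. a u v * a v w * a u w)"
  have D: "D = (\<Sum>u\<in>V. deg u)"
    by (simp add: D_def deg_def)
  \<comment> \<open>If \<open>a u v\<close> is 0, both sides vanish; if it is 1, this is x + y - 1
    \<le> x y for x, y in {0, 1}.\<close>
  have "a u v * a v w + a u v * a u w - a u v \<le> a u v * a v w * a u w" for u v w
    using a01[of u v] a01[of v w] a01[of u w] by auto
  then have "(\<Sum>u\<in>V. \<Sum>v\<in>V. \<Sum>w\<in>V. a u v * a v w + a u v * a u w - a u v) \<le> T"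
    unfolding T_def by (intro sum_mono)
  also have "(\<Sum>u\<in>V. \<Sum>v\<in>V. \<Sum>w\<in>V. a u v * a v w + a u v * a u w - a u v)
      = (\<Sum>u\<in>V. \<Sum>v\<in>V. a u v * deg v) + (\<Sum>u\<in>V. \<Sum>v\<in>V. a u v * deg u) - n * D"
    by (simp add: sum.distrib sum_subtractf deg_def D_def n_def sum_distrib_left)
  also have "(\<Sum>u\<in>V. \<Sum>v\<in>V. a u v * deg u) = S"
    by (simp add: S_def power2_eq_square deg_def flip: sum_distrib_right)
  also have "(\<Sum>u\<in>V. \<Sum>v\<in>V. a u v * deg v) = (\<Sum>v\<in>V. \<Sum>u\<in>V. a v u * deg v)"
    by (subst sum.swap) (simp add: sym)
  also have "\<dots> = S"
    by (simp add: S_def power2_eq_square deg_def flip: sum_distrib_right)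
  finally have T: "2 * S - n * D \<le> T"
    by simp
  have "D\<^sup>2 \<le> n * S"
    using sum_squared_le_sum_of_squares[of deg V]
    by (simp add: D S_def n_def mult.commute)
  moreover have "n * (2 * S - n * D) \<le> n * T"
    using T by (intro mult_left_mono) (simp_all add: n_def)
  ultimately show ?thesis
    unfolding T_def[symmetric] n_def[symmetric] by (simp add: algebra_simps power2_eq_square)
qed

lemma goodman_triangle_bound:
  assumes "finite V" and sym: "\<And>u v. E u v \<Longrightarrow> E v u"
  defines "D \<equiv> real (card {(u, v). u \<in> V \<and> v \<in> V \<and> E u v})"
  shows "D * (2 * D - (real (card V))\<^sup>2) \<le> real (card V)
    * real (card {(u, v, w). u \<in> V \<and> v \<in> V \<and> w \<in> V \<and> E u v \<and> E v w \<and> E u w})"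
proof -
  define a :: "'a \<Rightarrow> 'a \<Rightarrow> real" where "a u v = of_bool (E u v)" for u v
  have "{(u, v). u \<in> V \<and> v \<in> V \<and> E u v} = (V \<times> V) \<inter> {p. E (fst p) (snd p)}"
    by auto
  then have "D = (\<Sum>p\<in>V \<times> V. of_bool (E (fst p) (snd p)))"
    using \<open>finite V\<close> by (simp add: D_def)
  also have "\<dots> = (\<Sum>u\<in>V. \<Sum>v\<in>V. a u v)"
    by (simp only: a_def sum.cartesian_product case_prod_unfold)
  finally have D: "D = (\<Sum>u\<in>V. \<Sum>v\<in>V. a u v)" .
  let ?E3 = "\<lambda>(u, v, w). E u v \<and> E v w \<and> E u w"
  let ?T = "{(u, v, w). u \<in> V \<and> v \<in> V \<and> w \<in> V \<and> E u v \<and> E v w \<and> E u w}"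
  have "?T = (V \<times> V \<times> V) \<inter> {p. ?E3 p}"
    by auto
  then have "real (card ?T) = (\<Sum>p\<in>V \<times> V \<times> V. of_bool (?E3 p))"
    using \<open>finite V\<close> by simp
  also have "\<dots> = (\<Sum>u\<in>V. \<Sum>v\<in>V. \<Sum>w\<in>V. a u v * a v w * a u w)"
    by (simp only: a_def sum.cartesian_product case_prod_unfold of_bool_conj mult.assoc)
  finally have T: "real (card ?T) = (\<Sum>u\<in>V. \<Sum>v\<in>V. \<Sum>w\<in>V. a u v * a v w * a u w)" .
  show ?thesis
    unfolding D T
    using sym by (intro goodman_weighted_bound[OF \<open>finite V\<close>]) (auto simp: a_def)
qed

section \<open>Face numbers\<close>

lemma finite_simplicial_complex: "simplicial_complex V \<Delta> \<Longrightarrow> finite \<Delta>"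
  unfolding simplicial_complex_def by (meson finite_Pow_iff finite_subset)

lemma finite_face: "simplicial_complex V \<Delta> \<Longrightarrow> F \<in> \<Delta> \<Longrightarrow> finite F"
  unfolding simplicial_complex_def by (meson PowD finite_subset subsetD)

lemma face_number_eq: "face_number (int k - 1) \<Delta> = card {F \<in> \<Delta>. card F = k}"
  by (simp add: face_number_def face_dim_def)

text \<open>Each face of size k has k! orderings. This converts the ordered pairs and triples of the
  graph bound into face numbers.\<close>

lemma card_distinct_lists_of_faces:
  assumes "simplicial_complex V \<Delta>"
  shows "card {xs. distinct xs \<and> length xs = k \<and> set xs \<in> \<Delta>}
    = fact k * face_number (int k - 1) \<Delta>"
proof -
  let ?A = "{F \<in> \<Delta>. card F = k}"
  have "{xs. distinct xs \<and> length xs = k \<and> set xs \<in> \<Delta>} = (\<Union>F\<in>?A. permutations_of_set F)"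
    by (auto simp: permutations_of_set_def distinct_card)
  also have "card \<dots> = (\<Sum>F\<in>?A. card (permutations_of_set F))"
    using finite_simplicial_complex[OF assms]
    by (intro card_UN_disjoint) (auto dest: permutations_of_setD)
  also have "\<dots> = (\<Sum>F\<in>?A. fact k)"
    using finite_face[OF assms] by (intro sum.cong) auto
  finally show ?thesis
    by (simp add: face_number_eq mult.commute)
qed

lemma face_of_max_dim:
  assumes "simplicial_complex V \<Delta>" "complex_dim \<Delta> = int d - 1"
  obtains F where "F \<in> \<Delta>" "card F = d"
proof -
  have "Max (face_dim ` \<Delta>) \<in> face_dim ` \<Delta>"
    using assms finite_simplicial_complex[OF assms(1)]
    by (intro Max_in) (auto simp: simplicial_complex_def)
  with assms(2) that show thesis
    by (auto simp: complex_dim_def face_dim_def)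
qed

lemma card_face_le:
  assumes "simplicial_complex V \<Delta>" "complex_dim \<Delta> = int d - 1" "F \<in> \<Delta>"
  shows "card F \<le> d"
proof -
  have "face_dim F \<le> Max (face_dim ` \<Delta>)"
    using assms finite_simplicial_complex[OF assms(1)] by (intro Max_ge) auto
  with assms(2) show ?thesis
    by (simp add: complex_dim_def face_dim_def)
qed

lemma dim_le_card_vertices:
  assumes "simplicial_complex V \<Delta>" "complex_dim \<Delta> = int d - 1"
  shows "d \<le> card V"
proof -
  obtain F where "F \<in> \<Delta>" "card F = d"
    using assms by (rule face_of_max_dim)
  with assms(1) show ?thesis
    unfolding simplicial_complex_def by (auto intro!: card_mono)
qed

lemma face_number_empty_face:
  assumes "simplicial_complex V \<Delta>"
  shows "card {F \<in> \<Delta>. card F = 0} = 1"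
proof -
  have "{F \<in> \<Delta>. card F = 0} = {{}}"
    using assms finite_face[OF assms] by (auto simp: simplicial_complex_def)
  then show ?thesis
    by simp
qed

lemma face_number_vertices:
  assumes "simplicial_complex V \<Delta>"
  shows "card {F \<in> \<Delta>. card F = 1} = card V"
proof -
  have "{F \<in> \<Delta>. card F = 1} = (\<lambda>v. {v}) ` V"
    using assms by (auto simp: simplicial_complex_def card_1_singleton_iff)
  then show ?thesis
    by (simp add: card_image)
qed

lemma flag_triangle_bound:
  assumes sc: "simplicial_complex V \<Delta>" and flag: "flag_complex V \<Delta>"
  defines "n \<equiv> real (card V)" and "e \<equiv> real (face_number 1 \<Delta>)"
  shows "e * (4 * e - n\<^sup>2) \<le> 3 * n * real (face_number 2 \<Delta>)"
proof -
  define E where "E u v \<longleftrightarrow> u \<noteq> v \<and> {u, v} \<in> \<Delta>" for u v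
  have sub: "F \<subseteq> V" if "F \<in> \<Delta>" for F
    using sc that by (auto simp: simplicial_complex_def)
  have down: "G \<in> \<Delta>" if "F \<in> \<Delta>" "G \<subseteq> F" for F G
    using sc that by (auto simp: simplicial_complex_def)
  \<comment> \<open>Each proper subset of a graph triangle lies in one of its three edges and is a
    face, so a triangle that is not a face would be a missing face of dimension 2, which flagness
    excludes.\<close>
  have tri: "{u, v, w} \<in> \<Delta>" if "E u v" "E v w" "E u w" for u v w
  proof (rule ccontr)
    assume "{u, v, w} \<notin> \<Delta>"
    moreover have "G \<in> \<Delta>" if "G \<subset> {u, v, w}" for G
    proof -
      have "G \<subseteq> {u, v} \<or> G \<subseteq> {v, w} \<or> G \<subseteq> {u, w}"
        using that by blast
      with \<open>E u v\<close> \<open>E v w\<close> \<open>E u w\<close> down show ?thesis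
        by (auto simp: E_def)
    qed
    moreover have "{u, v, w} \<subseteq> V"
      using that sub by (auto simp: E_def)
    ultimately have "missing_face V \<Delta> {u, v, w}"
      by (simp add: missing_face_def)
    with flag have "face_dim {u, v, w} = 1"
      by (simp add: flag_complex_def)
    with that show False
      by (simp add: E_def face_dim_def)
  qed
  have "bij_betw (\<lambda>(u, v). [u, v]) {(u, v). u \<in> V \<and> v \<in> V \<and> E u v}
      {xs. distinct xs \<and> length xs = 2 \<and> set xs \<in> \<Delta>}"
    using sub
    by (intro bij_betwI[where g = "\<lambda>xs. (xs ! 0, xs ! 1)"])
       (fastforce simp: E_def length_Suc_conv numeral_2_eq_2)+
  then have D: "real (card {(u, v). u \<in> V \<and> v \<in> V \<and> E u v}) = 2 * e"
    using card_distinct_lists_of_faces[OF sc, of 2] by (simp add: bij_betw_same_card e_def)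
  \<comment> \<open>Graph triangles give faces by \<open>tri\<close>; conversely, the edges of a
    face are faces by \<open>down\<close>.\<close>
  have "bij_betw (\<lambda>(u, v, w). [u, v, w])
      {(u, v, w). u \<in> V \<and> v \<in> V \<and> w \<in> V \<and> E u v \<and> E v w \<and> E u w}
      {xs. distinct xs \<and> length xs = 3 \<and> set xs \<in> \<Delta>}"
    using sub tri down
    by (intro bij_betwI[where g = "\<lambda>xs. (xs ! 0, xs ! 1, xs ! 2)"])
       (fastforce simp: E_def length_Suc_conv numeral_3_eq_3 numeral_2_eq_2)+
  then have T: "real (card {(u, v, w). u \<in> V \<and> v \<in> V \<and> w \<in> V \<and> E u v \<and> E v w \<and> E u w})
      = 6 * real (face_number 2 \<Delta>)"
    using card_distinct_lists_of_faces[OF sc, of 3]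
    by (simp add: bij_betw_same_card fact_numeral)
  \<comment> \<open>The factors 2 = 2! and 6 = 3! come from the orderings of an edge and of a
    triangle.\<close>
  have "2 * e * (2 * (2 * e) - n\<^sup>2) \<le> n * (6 * real (face_number 2 \<Delta>))"
    using goodman_triangle_bound[of V E] sc D T
    by (auto simp: n_def E_def insert_commute simplicial_complex_def)
  then show ?thesis
    by (simp add: algebra_simps)
qed

section \<open>Dehn-Sommerville relations\<close>

lemma minus_one_powi_diff: "(-1 :: real) powi (int a - int b) = (-1) ^ (a + b)"
  by (simp add: power_int_diff power_add) (simp add: divide_inverse flip: power_inverse)

text \<open>Grouping faces by dimension removes \<open>complex_dim \<Gamma>\<close> from the
  formula, so the dimension of a link never has to be computed. The sign appears because dimension
  is size minus one.\<close>

lemma reduced_euler_char_eq: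
  assumes "finite \<Gamma>" "\<Gamma> \<noteq> {}"
  shows "reduced_euler_char \<Gamma> = - (\<Sum>\<sigma>\<in>\<Gamma>. (-1) ^ card \<sigma>)"
proof -
  let ?I = "{-1..complex_dim \<Gamma>}"
  have "face_dim ` \<Gamma> \<subseteq> ?I"
    using assms by (auto simp: complex_dim_def face_dim_def intro!: Max_ge)
  then have "(\<Sum>i\<in>?I. \<Sum>\<sigma>\<in>{\<sigma> \<in> \<Gamma>. face_dim \<sigma> = i}. (-1 :: real) powi face_dim \<sigma>)
      = (\<Sum>\<sigma>\<in>\<Gamma>. (-1) powi face_dim \<sigma>)"
    using assms by (intro sum.group) auto
  also have "\<dots> = (\<Sum>\<sigma>\<in>\<Gamma>. - ((-1) ^ card \<sigma>))"
    using minus_one_powi_diff[of _ 1] by (simp add: face_dim_def)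
  also have "(\<Sum>i\<in>?I. \<Sum>\<sigma>\<in>{\<sigma> \<in> \<Gamma>. face_dim \<sigma> = i}. (-1 :: real) powi face_dim \<sigma>)
      = reduced_euler_char \<Gamma>"
    by (simp add: reduced_euler_char_def face_number_def mult.commute)
  finally show ?thesis
    by (simp add: sum_negf)
qed

text \<open>Double counting of the pairs F \<subseteq> G of faces with F of size k, weighted by
  (-1)^|G|. For fixed F the Eulerian condition on its link makes the sum (-1)^d; a fixed G of size j
  contains j choose k such F.\<close>

lemma eulerian_dehn_sommerville:
  assumes sc: "simplicial_complex V \<Delta>" and dim: "complex_dim \<Delta> = int d - 1"
    and "eulerian \<Delta>"
  defines "g \<equiv> \<lambda>j. real (card {F \<in> \<Delta>. card F = j})"
  shows "(\<Sum>j\<le>d. (-1) ^ j * real (j choose k) * g j) = (-1) ^ d * g k"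
proof -
  let ?A = "{F \<in> \<Delta>. card F = k}"
  note fin = finite_simplicial_complex[OF sc] and finF = finite_face[OF sc]
  have down: "G \<in> \<Delta>" if "F \<in> \<Delta>" "G \<subseteq> F" for F G
    using sc that by (auto simp: simplicial_complex_def)
  have link: "(\<Sum>G\<in>{G \<in> \<Delta>. F \<subseteq> G}. (-1) ^ card G) = (-1 :: real) ^ d" if "F \<in> ?A" for F
  proof -
    have F: "F \<in> \<Delta>" "card F = k"
      using that by auto
    have "finite (link F \<Delta>)" "{} \<in> link F \<Delta>"
      using F fin down[of F "{}"] by (simp_all add: link_def)
    then have "reduced_euler_char (link F \<Delta>) = - (\<Sum>\<sigma>\<in>link F \<Delta>. (-1) ^ card \<sigma>)"
      by (intro reduced_euler_char_eq) auto
    \<comment> \<open>The exponent is (d - 1) - (k - 1) - 1 = d - (k + 1).\<close>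
    moreover have "reduced_euler_char (link F \<Delta>) = (-1) powi (int d - int (Suc k))"
      using \<open>eulerian \<Delta>\<close> F dim by (auto simp: eulerian_def face_dim_def algebra_simps)
    ultimately have *: "(\<Sum>\<sigma>\<in>link F \<Delta>. (-1) ^ card \<sigma>) = (-1 :: real) ^ (d + k)"
      by (simp only: minus_one_powi_diff) simp
    \<comment> \<open>Removing F is a bijection from the faces containing F onto the link; the
      factor (-1)^k it produces cancels the k in the exponent of \<open>*\<close>.\<close>
    have "(\<Sum>G\<in>{G \<in> \<Delta>. F \<subseteq> G}. (-1) ^ card G)
        = (\<Sum>\<sigma>\<in>link F \<Delta>. (-1) ^ k * (-1 :: real) ^ card \<sigma>)"
    proof (rule sum.reindex_bij_witness[where i = "\<lambda>\<sigma>. \<sigma> \<union> F" and j = "\<lambda>G. G - F"])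
      fix G assume G: "G \<in> {G \<in> \<Delta>. F \<subseteq> G}"
      then show "G - F \<in> link F \<Delta>"
        using down[of G "G - F"] by (auto simp: link_def Un_absorb2)
      have "card G = k + card (G - F)"
        using G F finF by (metis (no_types, lifting) card_Diff_subset card_mono finite_subset
            le_add_diff_inverse mem_Collect_eq)
      then show "(-1) ^ k * (-1 :: real) ^ card (G - F) = (-1) ^ card G"
        by (simp add: power_add)
    qed (auto simp: link_def)
    also have "\<dots> = (-1) ^ d"
      by (simp add: * power_add flip: sum_distrib_left)
    finally show ?thesis .
  qed
  have "(-1) ^ d * g k = (\<Sum>F\<in>?A. \<Sum>G\<in>{G \<in> \<Delta>. F \<subseteq> G}. (-1) ^ card G)"
    using link by (simp add: g_def)
  also have "\<dots> = (\<Sum>G\<in>\<Delta>. \<Sum>F\<in>{F \<in> ?A. F \<subseteq> G}. (-1) ^ card G)"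
    using fin by (intro sum.swap_restrict) auto
  also have "\<dots> = (\<Sum>G\<in>\<Delta>. (-1) ^ card G * real (card G choose k))"
  proof (intro sum.cong refl)
    fix G assume "G \<in> \<Delta>"
    then have "{F \<in> ?A. F \<subseteq> G} = {F. F \<subseteq> G \<and> card F = k}"
      using down by auto
    then show "(\<Sum>F\<in>{F \<in> ?A. F \<subseteq> G}. (-1) ^ card G) = (-1) ^ card G * real (card G choose k)"
      using n_subsets[OF finF[OF \<open>G \<in> \<Delta>\<close>]] by simp
  qed
  \<comment> \<open>The sizes 0 to d cover all faces by \<open>card_face_le\<close>.\<close>
  also have "\<dots> = (\<Sum>j\<le>d. \<Sum>G\<in>{G \<in> \<Delta>. card G = j}. (-1) ^ card G * real (card G choose k))"
    using fin card_face_le[OF sc dim] by (intro sum.group[symmetric]) auto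
  also have "\<dots> = (\<Sum>j\<le>d. (-1) ^ j * real (j choose k) * g j)"
    by (intro sum.cong refl) (simp add: g_def)
  finally show ?thesis
    by simp
qed

text \<open>With \<open>k = 3\<close> the relation reads 2 f_3 = f_2, and with \<open>k = 0\<close>
  it is Euler's relation f_1 - n = f_2 - f_3; eliminating f_3 leaves the claim.\<close>

lemma eulerian_triangles_dim3:
  assumes sc: "simplicial_complex V \<Delta>" and "complex_dim \<Delta> = 3" and "eulerian \<Delta>"
  shows "real (face_number 2 \<Delta>) = 2 * (real (face_number 1 \<Delta>) - real (card V))"
proof -
  have "complex_dim \<Delta> = int 4 - 1"
    using assms by simp
  note ds = eulerian_dehn_sommerville[OF sc this \<open>eulerian \<Delta>\<close>]
  show ?thesis
    using ds[of 0] ds[of 3] face_number_empty_face[OF sc] face_number_vertices[OF sc]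
      face_number_eq[of 2 \<Delta>] face_number_eq[of 3 \<Delta>]
    by (simp add: eval_nat_numeral)
qed

text \<open>The relations for \<open>k = 4\<close>, \<open>k = 2\<close> and \<open>k = 0\<close>
  are 2 f_3 = 5 f_4, 2 f_1 - 3 f_2 + 6 f_3 - 10 f_4 = 0 and 2 - n + f_1 - f_2 + f_3 - f_4 = 0. The
  first two express f_3 and f_4 by f_1 and f_2; the third then gives f_2.\<close>

lemma eulerian_triangles_dim4:
  assumes sc: "simplicial_complex V \<Delta>" and "complex_dim \<Delta> = 4" and "eulerian \<Delta>"
  shows "real (face_number 2 \<Delta>) = 4 * real (face_number 1 \<Delta>) - 10 * real (card V) + 20"
proof -
  have "complex_dim \<Delta> = int 5 - 1"
    using assms by simp
  note ds = eulerian_dehn_sommerville[OF sc this \<open>eulerian \<Delta>\<close>]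
  show ?thesis
    using ds[of 0] ds[of 2] ds[of 4] face_number_empty_face[OF sc] face_number_vertices[OF sc]
      face_number_eq[of 2 \<Delta>] face_number_eq[of 3 \<Delta>]
    by (simp add: eval_nat_numeral)
qed

text \<open>For positive e, inserting the bound on t and cancelling e leaves 4 e - n^2 < 6 c n. For
  e = 0 the right-hand side of the claim is positive.\<close>

lemma edge_bound:
  fixes e n t c :: real
  assumes "e * (4 * e - n\<^sup>2) \<le> 3 * n * t" "t < 2 * c * e" "0 \<le> e" "0 < n" "0 \<le> c"
  shows "e < n\<^sup>2 / 4 + 3 * c * n / 2"
proof (cases "e = 0")
  case True
  with assms show ?thesis
    by (simp add: add_pos_nonneg)
next
  case False
  have "3 * n * t < 3 * n * (2 * c * e)"
    using assms by simp
  with assms(1) have "e * (4 * e - n\<^sup>2) < e * (6 * c * n)"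
    by (simp add: algebra_simps)
  with False \<open>0 \<le> e\<close> show ?thesis
    by simp
qed

theorem corollary5p6:
  fixes V :: "'a set" and \<Delta> :: "'a set set" and d n :: nat
  assumes "simplicial_complex V \<Delta>"
    and "complex_dim \<Delta> = int d - 1"
    and "flag_complex V \<Delta>"
    and "eulerian \<Delta>"
    and "card V = n"
  shows "(d = 4 \<longrightarrow> real (face_number 1 \<Delta>) < (real n)\<^sup>2 / 4 + 3 * real n / 2) \<and>
         (d = 5 \<longrightarrow> real (face_number 1 \<Delta>) < (real n)\<^sup>2 / 4 + 3 * real n)"
proof -
  note tri = flag_triangle_bound[OF assms(1,3), unfolded assms(5)]
  \<comment> \<open>This makes \<open>t < 2 * c * e\<close> strict in \<open>edge_bound\<close>: for
    d = 4 and c = 1 because 2 (e - n) < 2 e, and for d = 5 and c = 2 because n \<ge> 5 makes -10 n +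
    20 negative.\<close>
  have "d \<le> n"
    using dim_le_card_vertices[OF assms(1,2)] assms(5) by simp
  then show ?thesis
    using edge_bound[OF tri, of 1] edge_bound[OF tri, of 2]
      eulerian_triangles_dim3[OF assms(1) _ assms(4)]
      eulerian_triangles_dim4[OF assms(1) _ assms(4)] assms(2,5)
    by auto
qed

end
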